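(* Suppose the iteration $\mathbf{SIP}$ (with the boundary-detected subgradient selection and the solution selection given in the context) converges to $x^*$. Then $x^*\in C_B$, where $$C_B=\{x\in\mathbb{R}^n \text{ nonconstant}: B(R_ix)\ge B(x)\ \text{ for all } i\in\{1,\dots,n\}\text{ with } R_ix\text{ nonconstant}\},$$ and $R_ix$ is the vector obtained from $x$ by replacing its $i$-th component $x_i$ by $-x_i$.
   Context: **Graph and functions.** $G=(V,E,w,\mu)$ is an undirected graph without loops, $V=\{1,\dots,n\}$, $n\ge2$, $E\ne\emptyset$; $\mu_i>0$ for $i\in V$; $w_{ij}=w_{ji}>0$ if $\{i,j\}\in E$, and $w_{ij}=0$ otherwise. $d_i=\sum_{j:\{i,j\}\in E}w_{ij}$, $e=\sum_i d_i$. For $x\in\mathbb{R}^n$: $\|x\|_\infty=\max_i|x_i|$, $\|x\|_1=\sum_i|x_i|$, $I^+(x)=\sum_{\{i,j\}\in E}w_{ij}|x_i+x_j|$, $N(x)=\min_{c\in\mathbb{R}}\sum_i\mu_i|x_i-c|$, $H_r(x)=\frac1e(I^+(x)+rN(x))$ for $r\ge0$. A vector is nonconstant if not all its components are equal. For nonconstant $x$, $B(x)=\frac{e\|x\|_\infty-I^+(x)}{N(x)}$. $\partial$ denotes the convex subdifferential; $\mathrm{sign}(t)=1$ if $t\ge0$ and $-1$ if $t<0$; $\delta_t(y)=1$ if $y=t$ and $\delta_t(y)=0$ otherwise. **Iteration $\mathbf{SIP}$.** Start from a nonconstant $x^0$, $r^0=B(x^0)$, $s^0\in\partial H_{r^0}(x^0)$,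 and for $k\ge0$ $$x^{k+1}\in\operatorname*{argmin}_{\|x\|_1\le1}\{\|x\|_\infty-\langle x,s^k\rangle\},\qquad r^{k+1}=B(x^{k+1}),\qquad s^{k+1}\in\partial H_{r^{k+1}}(x^{k+1}),$$ where the minimizer and the subgradient are selected as follows (random choices may be realized in any way). "$\mathbf{SIP}$ converges to $x^*$" means that there are $N\in\mathbb{Z}^+$ and $r^*$ with $r^k=r^*$ for all $k>N$, and $x^*=x^{k+1}$ for some $k>N$. **Solution selection (choice of $x^{k+1}$ given $s=s^k$).** Let $l_i=|s_i|$ (one always has $\|l\|_1\ge1$). (i) If $\|l\|_1>1$: relabel so that $l_1\ge\dots\ge l_n\ge l_{n+1}:=0$; let $A_0=0$, $A_m=\sum_{j=1}^m(l_j-l_{m+1})$, $m_0=\min\{m:A_m>1\}$, $m_1=\max\{m:A_{m-1}<1\}$ (so $m_1\le m_0$); put $z_i=1$ for $1\le i\le m_1$, $z_i=0$ for $m_0\le i\le n$ (except that $z_{m_0}=1$ if $m_1=m_0$), $z_i\in\{0,1\}$ chosen at random for $m_1<i<m_0$, and $x^{k+1}_i=\mathrm{sign}(s_i)z_i/\|z\|_1$. (ii) If $\|l\|_1=1$: let $\Gamma_1=\{i:s_i\neq0\}$ (nonempty), $\Gamma_0=\{i:s_i=0\}$. Put $x_i=\mathrm{sign}(s_i)$ for $i\in\Gamma_1$. If $\Gamma_0\ne\emptyset$: pick at random $j\in\Gamma_1$, $i\in\Gamma_0$, put $x_i=-x_j$, and choose $x_t\in\{-1,1\}$ at random for $t\in\Gamma_0\setminus\{i\}$.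 Finally $x^{k+1}=x/\|x\|_1$. **Boundary-detected subgradient selection (choice of $s\in\partial H_r(x)$ given $x=x^k$, $r=r^k$).** Take $\alpha\in\operatorname*{argmin}_{c}\sum_i\mu_i|x_i-c|$. Let $S^\pm=\{i:x_i=\pm\|x\|_\infty\}$, $S^<=\{i:|x_i|<\|x\|_\infty\}$, $S^\alpha=\{i:x_i=\alpha\}$, $A=\sum_{x_i<\alpha}\mu_i-\sum_{x_i>\alpha}\mu_i$, $M=\sum_{x_i=\alpha}\mu_i$. Define $a_i^L,a_i^R$ by: - if $i\in S^\alpha$ and $|S^\alpha|\ge2$: $a_i^L=\max\{A-M+\mu_i,-\mu_i\}$, $a_i^R=\min\{A+M-\mu_i,\mu_i\}$; - if $i\in S^\alpha$ and $|S^\alpha|\le1$: $a_i^L=a_i^R=A$; - if $i\notin S^\alpha$: $a_i^L=a_i^R=\mu_i\,\mathrm{sign}(x_i-\alpha)$. Let $\mathrm{NEN}(i)=\{j:\{i,j\}\in E,\ x_i+x_j=0\}$, $q_i=\sum_{j\in \mathrm{NEN}(i)}w_{ij}$, $p_i=\sum_{j:\{i,j\}\in E}w_{ij}\mathrm{sign}(x_i+x_j)-q_i$. Define - $a_i=\mu_i\mathrm{sign}(x_i-\alpha)$ if $i\notin S^\alpha$; $a_i=A$ if $i\in S^\alpha$ and $|S^\alpha|\le1$; and if $i\in S^\alpha$, $|S^\alpha|\ge2$: $a_i=a_i^L$ if $i\in S^+$, $a_i=a_i^R$ if $i\in S^-$, $a_i\in\operatorname*{argmax}_{t\in\{a_i^L,a_i^R\}}|p_i+rt|$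 if $i\in S^<$; - $b_i=p_i\mp q_i+ra_i$ if $i\in S^\pm$; $b_i=p_i+ra_i+\mathrm{sign}(p_i+ra_i)q_i$ if $i\in S^<$; - $\chi(i)=\mp1$ if $i\in S^\pm$, and $\chi(i)=\delta_{a_i}(a_i^R)-\delta_{a_i}(a_i^L)$ if $i\in S^<$; - $V_b=\operatorname*{argmax}_{i\in S^+}\{|b_i|:b_i<0\}\cup\operatorname*{argmax}_{i\in S^-}\{|b_i|:b_i>0\}\cup\operatorname*{argmax}_{i\in S^<}\{|b_i|:b_i\ne0\}$ (an argmax over an empty set is empty). Take a permutation $\sigma$ of $\{1,\dots,n\}$ with $|b_{\sigma(1)}|\le\dots\le|b_{\sigma(n)}|$, and write $\tau(i,j)$ for the element $t\in\{i,j\}$ with larger $\sigma^{-1}(t)$. Step 1: if $V_b\ne\emptyset$, pick at random $i^*\in V_b$, set $u_{i^*}=p_{i^*}+\sum_{j\in \mathrm{NEN}(i^* )}w_{i^*j}\chi(i^* )$, and for each $i\in \mathrm{NEN}(i^* )$ set $u_i=p_i+w_{ii^*}\chi(i^* )+\sum_{j\in \mathrm{NEN}(i)\setminus\{i^*\}}w_{ij}\chi(\tau(i,j))$. If $V_b=\emptyset$, skip this step. Step 2: for every remaining $i$, $u_i=p_i+\sum_{j\in \mathrm{NEN}(i)}w_{ij}\chi(\tau(i,j))$. Step 3: if $|S^\alpha|\le1$, $v_i=a_i$ for all $i$. If $|S^\alpha|\ge2$, let $j^*=i^*$ if $i^*$ was picked and $i^*\in S^\alpha$, else $j^*$ is the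 element of $S^\alpha$ with largest $\sigma^{-1}$; set $v_i=a_i$ for $i\in\{j^*\}\cup(V\setminus S^\alpha)$ and $v_i=\frac{A-a_{j^*}}{M-\mu_{j^*}}\mu_i$ for $i\in S^\alpha\setminus\{j^*\}$. The selected subgradient is $s=\frac1e(u+rv)$. *)

theory Defs
  imports "HOL-Analysis.Analysis"
begin

section \<open>Graphs and functions\<close>

text \<open>The vertex set is the finite type \<open>'n\<close>, so \<open>n\<close> is \<open>CARD('n)\<close> and vectors have type
  \<open>real ^ 'n\<close>. Edges are two-element sets of vertices.\<close>

record 'n wgraph =
  edges :: "'n set set"
  weight :: "'n \<Rightarrow> 'n \<Rightarrow> real"
  mass :: "'n \<Rightarrow> real"

definition weighted_graph :: "'n::finite wgraph \<Rightarrow> bool" where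
  "weighted_graph G \<longleftrightarrow>
     edges G \<noteq> {} \<and> (\<forall>e\<in>edges G. card e = 2) \<and>
     (\<forall>i. 0 < mass G i) \<and>
     (\<forall>i j. weight G i j = weight G j i) \<and>
     (\<forall>i j. {i, j} \<in> edges G \<longrightarrow> 0 < weight G i j) \<and>
     (\<forall>i j. {i, j} \<notin> edges G \<longrightarrow> weight G i j = 0)"

definition degree :: "'n::finite wgraph \<Rightarrow> 'n \<Rightarrow> real" where
  "degree G i = (\<Sum>j | {i, j} \<in> edges G. weight G i j)"

definition vol :: "'n::finite wgraph \<Rightarrow> real" where
  "vol G = (\<Sum>i\<in>UNIV. degree G i)"

text \<open>The maximum norm is \<^const>\<open>infnorm\<close>.\<close>

definition l1norm :: "real ^ 'n::finite \<Rightarrow> real" where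
  "l1norm x = (\<Sum>i\<in>UNIV. \<bar>x $ i\<bar>)"

text \<open>The sum runs over ordered pairs and hence counts every edge twice; the factor \<open>1 / 2\<close>
  makes it the sum over the (unordered) edges.\<close>

definition Iplus :: "'n::finite wgraph \<Rightarrow> real ^ 'n \<Rightarrow> real" where
  "Iplus G x = (\<Sum>(i, j) | {i, j} \<in> edges G. weight G i j * \<bar>x $ i + x $ j\<bar>) / 2"

definition deviation :: "'n::finite wgraph \<Rightarrow> real ^ 'n \<Rightarrow> real \<Rightarrow> real" where
  "deviation G x c = (\<Sum>i\<in>UNIV. mass G i * \<bar>x $ i - c\<bar>)"

text \<open>The infimum is attained, as the deviation is continuous in \<open>c\<close> and tends to infinity.\<close>

definition Nfun :: "'n::finite wgraph \<Rightarrow> real ^ 'n \<Rightarrow> real" where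
  "Nfun G x = (INF c. deviation G x c)"

definition Hfun :: "'n::finite wgraph \<Rightarrow> real \<Rightarrow> real ^ 'n \<Rightarrow> real" where
  "Hfun G r x = (Iplus G x + r * Nfun G x) / vol G"

definition nonconstant :: "real ^ 'n::finite \<Rightarrow> bool" where
  "nonconstant x \<longleftrightarrow> (\<exists>i j. x $ i \<noteq> x $ j)"

text \<open>Only meaningful for nonconstant \<open>x\<close>; otherwise the denominator is 0 and so is the value.\<close>

definition Bfun :: "'n::finite wgraph \<Rightarrow> real ^ 'n \<Rightarrow> real" where
  "Bfun G x = (vol G * infnorm x - Iplus G x) / Nfun G x"

definition subdifferential :: "('a::real_inner \<Rightarrow> real) \<Rightarrow> 'a \<Rightarrow> 'a set" where
  "subdifferential f x = {s. \<forall>y. f x + s \<bullet> (y - x) \<le> f y}"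

text \<open>Unlike \<^const>\<open>sgn\<close>, this takes the value 1 at 0.\<close>

definition sign1 :: "real \<Rightarrow> real" where
  "sign1 t = (if 0 \<le> t then 1 else -1)"

definition delta :: "real \<Rightarrow> real \<Rightarrow> real" where
  "delta t y = (if y = t then 1 else 0)"


section \<open>Solution selection\<close>

text \<open>The relabelling is an enumeration \<open>\<pi>\<close> of the vertices by \<open>{1..n}\<close>; the components of
  \<open>z\<close> are indexed by the new labels.\<close>

definition solution_case_i :: "real ^ 'n::finite \<Rightarrow> real ^ 'n \<Rightarrow> bool" where
  "solution_case_i s x \<longleftrightarrow>
     (\<exists>(\<pi> :: nat \<Rightarrow> 'n) (z :: nat \<Rightarrow> real).
        let n = CARD('n);
            l = (\<lambda>m. if m = n + 1 then 0 else \<bar>s $ \<pi> m\<bar>);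
            A = (\<lambda>m. \<Sum>j=1..m. l j - l (m + 1));
            m0 = Min {m \<in> {0..n}. 1 < A m};
            m1 = Max {m \<in> {1..n}. A (m - 1) < 1}
        in bij_betw \<pi> {1..n} UNIV \<and>
           (\<forall>m\<in>{1..n}. l (m + 1) \<le> l m) \<and>
           (\<forall>m\<in>{1..m1}. z m = 1) \<and>
           (\<forall>m\<in>{m0..n}. z m = (if m = m0 \<and> m1 = m0 then 1 else 0)) \<and>
           (\<forall>m. m1 < m \<and> m < m0 \<longrightarrow> z m \<in> {0, 1}) \<and>
           (\<forall>m\<in>{1..n}. x $ \<pi> m = sign1 (s $ \<pi> m) * z m / (\<Sum>j=1..n. \<bar>z j\<bar>)))"

definition solution_case_ii :: "real ^ 'n::finite \<Rightarrow> real ^ 'n \<Rightarrow> bool" where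
  "solution_case_ii s x \<longleftrightarrow>
     (\<exists>y :: real ^ 'n.
        let \<Gamma>1 = {i. s $ i \<noteq> 0}; \<Gamma>0 = {i. s $ i = 0}
        in (\<forall>i\<in>\<Gamma>1. y $ i = sign1 (s $ i)) \<and>
           (\<Gamma>0 \<noteq> {} \<longrightarrow>
              (\<exists>j\<in>\<Gamma>1. \<exists>i\<in>\<Gamma>0. y $ i = - y $ j \<and> (\<forall>t\<in>\<Gamma>0 - {i}. y $ t \<in> {-1, 1}))) \<and>
           x = (1 / l1norm y) *\<^sub>R y)"

definition solution_selection :: "real ^ 'n::finite \<Rightarrow> real ^ 'n \<Rightarrow> bool" where
  "solution_selection s x \<longleftrightarrow>
     (1 < l1norm s \<and> solution_case_i s x) \<or> (l1norm s = 1 \<and> solution_case_ii s x)"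


section \<open>Boundary-detected subgradient selection\<close>

definition Splus :: "real ^ 'n::finite \<Rightarrow> 'n set" where
  "Splus x = {i. x $ i = infnorm x}"

definition Sminus :: "real ^ 'n::finite \<Rightarrow> 'n set" where
  "Sminus x = {i. x $ i = - infnorm x}"

definition Sless :: "real ^ 'n::finite \<Rightarrow> 'n set" where
  "Sless x = {i. \<bar>x $ i\<bar> < infnorm x}"

definition Salpha :: "real ^ 'n::finite \<Rightarrow> real \<Rightarrow> 'n set" where
  "Salpha x \<alpha> = {i. x $ i = \<alpha>}"

definition Aval :: "'n::finite wgraph \<Rightarrow> real ^ 'n \<Rightarrow> real \<Rightarrow> real" where
  "Aval G x \<alpha> = (\<Sum>i | x $ i < \<alpha>. mass G i) - (\<Sum>i | x $ i > \<alpha>. mass G i)"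

definition Mval :: "'n::finite wgraph \<Rightarrow> real ^ 'n \<Rightarrow> real \<Rightarrow> real" where
  "Mval G x \<alpha> = (\<Sum>i | x $ i = \<alpha>. mass G i)"

definition aL :: "'n::finite wgraph \<Rightarrow> real ^ 'n \<Rightarrow> real \<Rightarrow> 'n \<Rightarrow> real" where
  "aL G x \<alpha> i =
     (if i \<in> Salpha x \<alpha> then
        if 2 \<le> card (Salpha x \<alpha>)
        then max (Aval G x \<alpha> - Mval G x \<alpha> + mass G i) (- mass G i)
        else Aval G x \<alpha>
      else mass G i * sign1 (x $ i - \<alpha>))"

definition aR :: "'n::finite wgraph \<Rightarrow> real ^ 'n \<Rightarrow> real \<Rightarrow> 'n \<Rightarrow> real" where
  "aR G x \<alpha> i =
     (if i \<in> Salpha x \<alpha> then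
        if 2 \<le> card (Salpha x \<alpha>)
        then min (Aval G x \<alpha> + Mval G x \<alpha> - mass G i) (mass G i)
        else Aval G x \<alpha>
      else mass G i * sign1 (x $ i - \<alpha>))"

definition NEN :: "'n::finite wgraph \<Rightarrow> real ^ 'n \<Rightarrow> 'n \<Rightarrow> 'n set" where
  "NEN G x i = {j. {i, j} \<in> edges G \<and> x $ i + x $ j = 0}"

definition qval :: "'n::finite wgraph \<Rightarrow> real ^ 'n \<Rightarrow> 'n \<Rightarrow> real" where
  "qval G x i = (\<Sum>j\<in>NEN G x i. weight G i j)"

definition pval :: "'n::finite wgraph \<Rightarrow> real ^ 'n \<Rightarrow> 'n \<Rightarrow> real" where
  "pval G x i = (\<Sum>j | {i, j} \<in> edges G. weight G i j * sign1 (x $ i + x $ j)) - qval G x i"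

definition a_choice ::
  "'n::finite wgraph \<Rightarrow> real ^ 'n \<Rightarrow> real \<Rightarrow> real \<Rightarrow> ('n \<Rightarrow> real) \<Rightarrow> bool" where
  "a_choice G x r \<alpha> a \<longleftrightarrow>
     (\<forall>i. (i \<notin> Salpha x \<alpha> \<longrightarrow> a i = mass G i * sign1 (x $ i - \<alpha>)) \<and>
          (i \<in> Salpha x \<alpha> \<and> card (Salpha x \<alpha>) \<le> 1 \<longrightarrow> a i = Aval G x \<alpha>) \<and>
          (i \<in> Salpha x \<alpha> \<and> 2 \<le> card (Salpha x \<alpha>) \<longrightarrow>
             (i \<in> Splus x \<longrightarrow> a i = aL G x \<alpha> i) \<and>
             (i \<in> Sminus x \<longrightarrow> a i = aR G x \<alpha> i) \<and>
             (i \<in> Sless x \<longrightarrow>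
                is_arg_max (\<lambda>t. \<bar>pval G x i + r * t\<bar>) (\<lambda>t. t \<in> {aL G x \<alpha> i, aR G x \<alpha> i}) (a i))))"

definition bval :: "'n::finite wgraph \<Rightarrow> real ^ 'n \<Rightarrow> real \<Rightarrow> ('n \<Rightarrow> real) \<Rightarrow> 'n \<Rightarrow> real" where
  "bval G x r a i =
     (if i \<in> Splus x then pval G x i - qval G x i + r * a i
      else if i \<in> Sminus x then pval G x i + qval G x i + r * a i
      else pval G x i + r * a i + sign1 (pval G x i + r * a i) * qval G x i)"

definition chi :: "'n::finite wgraph \<Rightarrow> real ^ 'n \<Rightarrow> real \<Rightarrow> ('n \<Rightarrow> real) \<Rightarrow> 'n \<Rightarrow> real" where
  "chi G x \<alpha> a i =
     (if i \<in> Splus x then -1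
      else if i \<in> Sminus x then 1
      else delta (a i) (aR G x \<alpha> i) - delta (a i) (aL G x \<alpha> i))"

definition Vb :: "real ^ 'n::finite \<Rightarrow> ('n \<Rightarrow> real) \<Rightarrow> 'n set" where
  "Vb x b =
     {i. is_arg_max (\<lambda>i. \<bar>b i\<bar>) (\<lambda>i. i \<in> Splus x \<and> b i < 0) i} \<union>
     {i. is_arg_max (\<lambda>i. \<bar>b i\<bar>) (\<lambda>i. i \<in> Sminus x \<and> 0 < b i) i} \<union>
     {i. is_arg_max (\<lambda>i. \<bar>b i\<bar>) (\<lambda>i. i \<in> Sless x \<and> b i \<noteq> 0) i}"

text \<open>The permutation \<open>\<sigma>\<close> enumerates the vertices by \<open>{1..n}\<close>, and \<open>rank_of \<sigma>\<close> is its inverse.\<close>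

definition rank_of :: "(nat \<Rightarrow> 'n::finite) \<Rightarrow> 'n \<Rightarrow> nat" where
  "rank_of \<sigma> = inv_into {1..CARD('n)} \<sigma>"

definition sorts_abs :: "('n::finite \<Rightarrow> real) \<Rightarrow> (nat \<Rightarrow> 'n) \<Rightarrow> bool" where
  "sorts_abs b \<sigma> \<longleftrightarrow>
     bij_betw \<sigma> {1..CARD('n)} UNIV \<and>
     (\<forall>k l. 1 \<le> k \<and> k \<le> l \<and> l \<le> CARD('n) \<longrightarrow> \<bar>b (\<sigma> k)\<bar> \<le> \<bar>b (\<sigma> l)\<bar>)"

definition tau :: "(nat \<Rightarrow> 'n::finite) \<Rightarrow> 'n \<Rightarrow> 'n \<Rightarrow> 'n" where
  "tau \<sigma> i j = (if rank_of \<sigma> i \<le> rank_of \<sigma> j then j else i)"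

text \<open>In the following, \<open>c\<close> stands for the function \<open>chi G x \<alpha> a\<close>, and the picked vertex is an
  option value, with \<^const>\<open>None\<close> if no vertex is picked.\<close>

definition uval ::
  "'n::finite wgraph \<Rightarrow> real ^ 'n \<Rightarrow> ('n \<Rightarrow> real) \<Rightarrow> (nat \<Rightarrow> 'n) \<Rightarrow> 'n option \<Rightarrow> 'n \<Rightarrow> real" where
  "uval G x c \<sigma> picked i =
     (let step2 = pval G x i + (\<Sum>j\<in>NEN G x i. weight G i j * c (tau \<sigma> i j))
      in case picked of
           None \<Rightarrow> step2
         | Some k \<Rightarrow>
             if i = k then pval G x k + (\<Sum>j\<in>NEN G x k. weight G k j * c k)
             else if i \<in> NEN G x k then
               pval G x i + weight G i k * c k +
               (\<Sum>j\<in>NEN G x i - {k}. weight G i j * c (tau \<sigma> i j))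
             else step2)"

definition jstar :: "'n::finite set \<Rightarrow> (nat \<Rightarrow> 'n) \<Rightarrow> 'n option \<Rightarrow> 'n" where
  "jstar S \<sigma> picked =
     (case picked of
        None \<Rightarrow> (ARG_MAX (rank_of \<sigma>) i. i \<in> S)
      | Some k \<Rightarrow> if k \<in> S then k else (ARG_MAX (rank_of \<sigma>) i. i \<in> S))"

definition vval ::
  "'n::finite wgraph \<Rightarrow> real ^ 'n \<Rightarrow> real \<Rightarrow> ('n \<Rightarrow> real) \<Rightarrow> (nat \<Rightarrow> 'n) \<Rightarrow> 'n option \<Rightarrow> 'n \<Rightarrow> real"
where
  "vval G x \<alpha> a \<sigma> picked i =
     (let j = jstar (Salpha x \<alpha>) \<sigma> picked
      in if 2 \<le> card (Salpha x \<alpha>) \<and> i \<in> Salpha x \<alpha> - {j}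
         then (Aval G x \<alpha> - a j) / (Mval G x \<alpha> - mass G j) * mass G i
         else a i)"

definition subgradient_selection ::
  "'n::finite wgraph \<Rightarrow> real ^ 'n \<Rightarrow> real \<Rightarrow> real ^ 'n \<Rightarrow> bool" where
  "subgradient_selection G x r s \<longleftrightarrow>
     (\<exists>\<alpha> a \<sigma> picked.
        is_arg_min (deviation G x) (\<lambda>_. True) \<alpha> \<and>
        a_choice G x r \<alpha> a \<and>
        sorts_abs (bval G x r a) \<sigma> \<and>
        (case picked of
           None \<Rightarrow> Vb x (bval G x r a) = {}
         | Some k \<Rightarrow> k \<in> Vb x (bval G x r a)) \<and>
        s = (\<chi> i. (uval G x (chi G x \<alpha> a) \<sigma> picked i + r * vval G x \<alpha> a \<sigma> picked i) / vol G))"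


section \<open>The iteration\<close>

definition SIP ::
  "'n::finite wgraph \<Rightarrow> (nat \<Rightarrow> real ^ 'n) \<Rightarrow> (nat \<Rightarrow> real) \<Rightarrow> (nat \<Rightarrow> real ^ 'n) \<Rightarrow> bool" where
  "SIP G x r s \<longleftrightarrow>
     nonconstant (x 0) \<and>
     (\<forall>k. r k = Bfun G (x k)) \<and>
     (\<forall>k. s k \<in> subdifferential (Hfun G (r k)) (x k) \<and>
          subgradient_selection G (x k) (r k) (s k)) \<and>
     (\<forall>k. is_arg_min (\<lambda>y. infnorm y - y \<bullet> s k) (\<lambda>y. l1norm y \<le> 1) (x (Suc k)) \<and>
          solution_selection (s k) (x (Suc k)))"

definition SIP_converges_to ::
  "(nat \<Rightarrow> real ^ 'n::finite) \<Rightarrow> (nat \<Rightarrow> real) \<Rightarrow> real ^ 'n \<Rightarrow> bool" where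
  "SIP_converges_to x r xstar \<longleftrightarrow>
     (\<exists>N>0. \<exists>rstar. (\<forall>k>N. r k = rstar) \<and> (\<exists>k>N. xstar = x (Suc k)))"

definition reflect :: "'n::finite \<Rightarrow> real ^ 'n \<Rightarrow> real ^ 'n" where
  "reflect i x = (\<chi> j. if j = i then - x $ j else x $ j)"

definition CB :: "'n::finite wgraph \<Rightarrow> (real ^ 'n) set" where
  "CB G =
     {x. nonconstant x \<and> (\<forall>i. nonconstant (reflect i x) \<longrightarrow> Bfun G x \<le> Bfun G (reflect i x))}"

end

theory Submission
  imports Defs
begin

text \<open>
  For nonconstant \<open>x\<close>, the definition of \<open>B\<close> says \<open>H\<^sub>r(x) = \<parallel>x\<parallel>\<^sub>\<infinity>\<close> for \<open>r = B(x)\<close>. Since \<open>H\<^sub>r\<close> is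
  positively homogeneous, a subgradient \<open>s\<close> at \<open>x\<close> satisfies \<open>\<langle>x, s\<rangle> = H\<^sub>r(x)\<close> and
  \<open>\<langle>y, s\<rangle> \<le> H\<^sub>r(y)\<close> for all \<open>y\<close>. If \<open>B\<close> does not change from \<open>x\<close> to the next iterate \<open>x'\<close>, then
  \<open>\<parallel>x'\<parallel>\<^sub>\<infinity> - \<langle>x', s\<rangle> \<ge> \<parallel>x'\<parallel>\<^sub>\<infinity> - H\<^sub>r(x') = 0\<close>, so the minimum of the inner problem is not negative,
  and comparing with the sign vector of \<open>s\<close> gives \<open>\<parallel>s\<parallel>\<^sub>1 \<le> 1\<close> (\<open>SIP_stationary\<close>). This has two effects
  once \<open>B\<close> is constant along the iteration.

  First, the solution is selected by the rule for \<open>\<parallel>s\<parallel>\<^sub>1 = 1\<close>, and therefore the limit \<open>x\<^sup>*\<close> takes only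
  the values \<open>\<plusminus>c\<close> for some \<open>c > 0\<close>. Second, the subgradient \<open>s\<close> selected at \<open>x\<^sup>*\<close> also has
  \<open>\<parallel>s\<parallel>\<^sub>1 \<le> 1\<close> while \<open>\<langle>x\<^sup>*, s\<rangle> = \<parallel>x\<^sup>*\<parallel>\<^sub>\<infinity>\<close>; equality in Hoelder's inequality forces
  \<open>x\<^sup>*\<^sub>i s\<^sub>i \<ge> 0\<close> for every \<open>i\<close>.

  The number \<open>b\<^sub>i\<close> of the boundary detection is, up to the positive factor \<open>e\<close>, the extreme value of
  the \<open>i\<close>-th component over all subgradients, in the direction opposite to the sign of \<open>x\<^sup>*\<^sub>i\<close>. If some
  \<open>b\<^sub>i\<close> has the wrong sign, a vertex \<open>k\<close> is picked and the selection realizes \<open>s\<^sub>k = b\<^sub>k / e\<close>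
  with \<open>x\<^sup>*\<^sub>k b\<^sub>k < 0\<close>, which was just excluded. Hence \<open>x\<^sup>*\<^sub>i b\<^sub>i \<ge> 0\<close> for every \<open>i\<close>.

  It remains to see that \<open>b\<^sub>i\<close> controls the flip of the \<open>i\<close>-th sign. On vectors with values \<open>\<plusminus>c\<close> the
  flip changes \<open>I\<^sup>+\<close> by exactly \<open>-2 x\<^sub>i (p\<^sub>i \<mp> q\<^sub>i)\<close> (\<open>Iplus_reflect\<close>, \<open>bval_two_valued\<close>) and raises
  \<open>N\<close> by at most \<open>-2 x\<^sub>i a\<^sub>i\<close> (\<open>Nfun_reflect_le\<close>). Since \<open>r \<ge> 0\<close>, the sum \<open>I\<^sup>+ + r N\<close> grows by at most
  \<open>-2 x\<^sub>i b\<^sub>i \<le> 0\<close>; as the maximum norm is unchanged, \<open>B\<close> does not decrease.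
\<close>


section \<open>The energies\<close>

lemma infnorm_le: "infnorm x \<le> c" if "\<And>i. \<bar>x $ i\<bar> \<le> c" for x :: "real ^ 'n::finite"
  unfolding infnorm_cart by (rule cSup_least) (use that in auto)

lemma infnorm_eq: "infnorm x = c" if "\<And>i. \<bar>x $ i\<bar> = c" for x :: "real ^ 'n::finite"
  using infnorm_le[of x c] component_le_infnorm_cart[of x undefined] that[of undefined] that
  by (metis order_antisym order_refl)

context
  fixes G :: "'n::finite wgraph"
  assumes graph: "weighted_graph G"
begin

lemma weight_nonneg: "0 \<le> weight G i j"
  using graph unfolding weighted_graph_def by (metis less_eq_real_def)

lemma weight_sym: "weight G i j = weight G j i"
  using graph unfolding weighted_graph_def by blast

lemma weight_off_edge: "{i, j} \<notin> edges G \<Longrightarrow> weight G i j = 0"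
  using graph unfolding weighted_graph_def by blast

lemma weight_loop: "weight G i i = 0"
proof (rule weight_off_edge)
  show "{i, i} \<notin> edges G"
    using graph unfolding weighted_graph_def by force
qed

lemma mass_pos: "0 < mass G i"
  using graph unfolding weighted_graph_def by blast

lemma sum_neighbours:
  "(\<Sum>j | {i, j} \<in> edges G. weight G i j * f j) = (\<Sum>j\<in>UNIV. weight G i j * f j)"
  by (rule sum.mono_neutral_left) (auto simp: weight_off_edge)

lemma vol_eq: "vol G = (\<Sum>i\<in>UNIV. \<Sum>j\<in>UNIV. weight G i j)"
  unfolding vol_def degree_def using sum_neighbours[of _ "\<lambda>_. 1"] by simp

lemma vol_pos: "0 < vol G"
proof -
  obtain e where e: "e \<in> edges G" "card e = 2"
    using graph unfolding weighted_graph_def by blast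
  then obtain i j where ij: "{i, j} \<in> edges G"
    by (metis card_2_iff)
  have w: "0 < weight G i j"
    using graph ij unfolding weighted_graph_def by blast
  have "weight G i j \<le> (\<Sum>j\<in>UNIV. weight G i j)"
    by (rule member_le_sum) (auto simp: weight_nonneg)
  also have "\<dots> \<le> (\<Sum>i\<in>UNIV. \<Sum>j\<in>UNIV. weight G i j)"
    by (rule member_le_sum[where f = "\<lambda>i. \<Sum>j\<in>UNIV. weight G i j"])
      (auto intro: sum_nonneg simp: weight_nonneg)
  finally show ?thesis using w by (simp add: vol_eq)
qed

lemma Iplus_eq: "Iplus G x = (\<Sum>i\<in>UNIV. \<Sum>j\<in>UNIV. weight G i j * \<bar>x $ i + x $ j\<bar>) / 2"
proof -
  have "(\<Sum>(i, j) | {i, j} \<in> edges G. weight G i j * \<bar>x $ i + x $ j\<bar>)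
      = (\<Sum>(i, j)\<in>UNIV \<times> UNIV. weight G i j * \<bar>x $ i + x $ j\<bar>)"
    by (rule sum.mono_neutral_left) (auto, metis weight_off_edge)
  thus ?thesis
    unfolding Iplus_def by (simp add: sum.cartesian_product)
qed

lemma Iplus_le: "Iplus G x \<le> vol G * infnorm x"
proof -
  have "weight G i j * \<bar>x $ i + x $ j\<bar> \<le> weight G i j * (2 * infnorm x)" for i j
    using component_le_infnorm_cart[of x i] component_le_infnorm_cart[of x j]
    by (intro mult_left_mono weight_nonneg) linarith
  hence "(\<Sum>i\<in>UNIV. \<Sum>j\<in>UNIV. weight G i j * \<bar>x $ i + x $ j\<bar>)
      \<le> (\<Sum>i\<in>UNIV. \<Sum>j\<in>UNIV. weight G i j * (2 * infnorm x))"
    by (intro sum_mono)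
  also have "\<dots> = vol G * (2 * infnorm x)"
    by (simp add: vol_eq sum_distrib_right)
  finally show ?thesis
    unfolding Iplus_eq by simp
qed

lemma Iplus_double: "Iplus G (2 *\<^sub>R x) = 2 * Iplus G x"
proof -
  have "weight G i j * \<bar>(2 *\<^sub>R x) $ i + (2 *\<^sub>R x) $ j\<bar>
      = 2 * (weight G i j * \<bar>x $ i + x $ j\<bar>)" for i j
    by (simp add: abs_if)
  thus ?thesis
    unfolding Iplus_eq by (simp only: sum_distrib_left[symmetric])
qed

lemma deviation_nonneg: "0 \<le> deviation G x c"
  unfolding deviation_def by (intro sum_nonneg mult_nonneg_nonneg) (auto simp: mass_pos less_imp_le)

lemma Nfun_le: "Nfun G x \<le> deviation G x c"
  unfolding Nfun_def
  by (rule cINF_lower) (auto intro!: bdd_belowI[of _ 0] simp: deviation_nonneg)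

lemma Nfun_greatest: "c \<le> Nfun G x" if "\<And>t. c \<le> deviation G x t"
  unfolding Nfun_def by (rule cINF_greatest) (auto simp: that)

lemma Nfun_attained: "Nfun G x = deviation G x \<alpha>" if "is_arg_min (deviation G x) (\<lambda>_. True) \<alpha>"
  using that Nfun_le[of x \<alpha>] Nfun_greatest[of "deviation G x \<alpha>" x]
  by (auto simp: is_arg_min_linorder)

lemma Nfun_nonneg: "0 \<le> Nfun G x"
  by (rule Nfun_greatest) (rule deviation_nonneg)

lemma Nfun_pos: "0 < Nfun G x" if nc: "nonconstant x"
proof -
  obtain i j where ij: "x $ i \<noteq> x $ j"
    using nc by (auto simp: nonconstant_def)
  hence "i \<noteq> j" by blast
  define m where "m = min (mass G i) (mass G j)"
  have m: "0 < m" "m \<le> mass G i" "m \<le> mass G j"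
    by (auto simp: m_def mass_pos)
  have "m * \<bar>x $ i - x $ j\<bar> \<le> deviation G x c" for c
  proof -
    have "m * \<bar>x $ i - x $ j\<bar> \<le> m * \<bar>x $ i - c\<bar> + m * \<bar>x $ j - c\<bar>"
      using m(1) by (subst distrib_left[symmetric]) (intro mult_left_mono, auto)
    also have "\<dots> \<le> mass G i * \<bar>x $ i - c\<bar> + mass G j * \<bar>x $ j - c\<bar>"
      using m by (intro add_mono mult_right_mono) auto
    also have "\<dots> = (\<Sum>k\<in>{i, j}. mass G k * \<bar>x $ k - c\<bar>)"
      using \<open>i \<noteq> j\<close> by simp
    also have "\<dots> \<le> deviation G x c"
      unfolding deviation_def
      by (intro sum_mono2) (auto intro!: mult_nonneg_nonneg simp: mass_pos less_imp_le)
    finally show ?thesis .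
  qed
  hence "m * \<bar>x $ i - x $ j\<bar> \<le> Nfun G x"
    by (rule Nfun_greatest)
  moreover have "0 < m * \<bar>x $ i - x $ j\<bar>"
    using m ij by simp
  ultimately show ?thesis by linarith
qed

lemma Nfun_constant: "Nfun G x = 0" if "\<not> nonconstant x"
proof -
  have "x $ i = x $ undefined" for i using that by (auto simp: nonconstant_def)
  hence "mass G i * \<bar>x $ i - x $ undefined\<bar> = 0" for i by simp
  hence "deviation G x (x $ undefined) = 0"
    unfolding deviation_def by (intro sum.neutral ballI)
  thus ?thesis using Nfun_le[of x "x $ undefined"] Nfun_nonneg[of x] by simp
qed

lemma Nfun_double: "Nfun G (2 *\<^sub>R x) \<le> 2 * Nfun G x"
proof -
  have "deviation G (2 *\<^sub>R x) (2 * c) = 2 * deviation G x c" for c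
  proof -
    have "\<bar>2 * x $ i - 2 * c\<bar> = 2 * \<bar>x $ i - c\<bar>" for i by (simp add: abs_if)
    thus ?thesis by (simp add: deviation_def sum_distrib_left mult_ac)
  qed
  hence "Nfun G (2 *\<^sub>R x) / 2 \<le> deviation G x c" for c
    using Nfun_le[of "2 *\<^sub>R x" "2 * c"] by simp
  hence "Nfun G (2 *\<^sub>R x) / 2 \<le> Nfun G x" by (rule Nfun_greatest)
  thus ?thesis by simp
qed

lemma Bfun_nonneg: "0 \<le> Bfun G x"
  unfolding Bfun_def using Iplus_le[of x] Nfun_nonneg[of x] by simp

lemma Hfun_le_iff_le_Bfun:
  "Hfun G r x \<le> infnorm x \<longleftrightarrow> r \<le> Bfun G x" if "nonconstant x"
  unfolding Hfun_def Bfun_def using vol_pos Nfun_pos[OF that]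
  by (simp add: divide_simps) (simp add: algebra_simps)

lemma Hfun_Bfun: "Hfun G (Bfun G x) x = infnorm x" if "nonconstant x"
  unfolding Hfun_def Bfun_def using vol_pos Nfun_pos[OF that] by simp

text \<open>Constant vectors can never push the objective \<open>\<parallel>y\<parallel>\<^sub>\<infinity> - \<langle>y, s\<rangle>\<close> of the inner problem
  below 0, because \<open>\<langle>y, s\<rangle> \<le> H\<^sub>r(y)\<close>; this is what keeps the iterates nonconstant.\<close>

lemma Hfun_constant_le: "Hfun G r x \<le> infnorm x" if "\<not> nonconstant x"
  unfolding Hfun_def using vol_pos Nfun_constant[OF that] Iplus_le[of x]
  by (simp add: divide_simps mult.commute)

text \<open>Euler's identity for the homogeneous function \<open>H\<^sub>r\<close>: testing the subgradient inequality
  with 0 and with \<open>2 x\<close> bounds \<open>\<langle>x, s\<rangle>\<close> from both sides by \<open>H\<^sub>r(x)\<close>.\<close>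

lemma subgradient_Hfun:
  assumes "0 \<le> r" and s: "s \<in> subdifferential (Hfun G r) x"
  shows subgradient_inner: "s \<bullet> x = Hfun G r x"
    and subgradient_inner_le: "s \<bullet> y \<le> Hfun G r y"
proof -
  have sub: "Hfun G r x + s \<bullet> (y - x) \<le> Hfun G r y" for y
    using s by (simp add: subdifferential_def)
  have 0: "Hfun G r 0 = 0"
    using Nfun_constant[of 0] by (simp add: Hfun_def Iplus_eq nonconstant_def)
  have "Iplus G (2 *\<^sub>R x) + r * Nfun G (2 *\<^sub>R x) \<le> 2 * (Iplus G x + r * Nfun G x)"
    using mult_left_mono[OF Nfun_double[of x] \<open>0 \<le> r\<close>] by (simp add: Iplus_double algebra_simps)
  hence 2: "Hfun G r (2 *\<^sub>R x) \<le> 2 * Hfun G r x"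
    unfolding Hfun_def using vol_pos by (simp add: divide_right_mono)
  have "Hfun G r x - s \<bullet> x \<le> 0"
    using sub[of 0] by (simp add: 0)
  moreover have "s \<bullet> x \<le> Hfun G r x"
    using sub[of "2 *\<^sub>R x"] 2 by (simp add: scaleR_2)
  ultimately show eq: "s \<bullet> x = Hfun G r x" by simp
  show "s \<bullet> y \<le> Hfun G r y"
    using sub[of y] by (simp add: eq inner_diff_right)
qed


section \<open>Flipping one sign of a two-valued vector\<close>

lemma infnorm_reflect: "infnorm (reflect i x) = infnorm x" for x :: "real ^ 'n::finite"
  unfolding infnorm_cart by (rule arg_cong[where f = Sup]) (auto simp: reflect_def)

text \<open>On vectors with values \<open>\<plusminus>c\<close> one has \<open>\<bar>x\<^sub>i + x\<^sub>j\<bar> = c + x\<^sub>i x\<^sub>j / c\<close>, so \<open>I\<^sup>+\<close> is an affine function of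
  a quadratic form without diagonal terms. Its change under a flip is linear in the flipped entry.\<close>

lemma Iplus_reflect:
  assumes c: "0 < c" and x: "\<And>j. \<bar>x $ j\<bar> = c"
  shows "Iplus G (reflect k x) = Iplus G x - 2 * x $ k * ((\<Sum>j\<in>UNIV. weight G k j * x $ j) / c)"
proof -
  have abs: "\<bar>y $ i + y $ j\<bar> = c + y $ i * y $ j / c" if "\<And>j. \<bar>y $ j\<bar> = c" for i j and y :: "real ^ 'n"
    using that[of i] that[of j] c by (auto simp: abs_if split: if_splits)
  have quad: "2 * Iplus G y = (\<Sum>i\<in>UNIV. \<Sum>j\<in>UNIV. weight G i j * c)
      + (\<Sum>i\<in>UNIV. \<Sum>j\<in>UNIV. weight G i j * (y $ i * y $ j)) / c" if "\<And>j. \<bar>y $ j\<bar> = c" for y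
    unfolding Iplus_eq abs[OF that]
    by (simp add: distrib_left sum.distrib sum_divide_distrib)
  define y where "y = reflect k x"
  define R where "R = x $ k * (\<Sum>j\<in>UNIV. weight G k j * x $ j)"
  have y: "\<bar>y $ j\<bar> = c" for j
    by (simp add: y_def reflect_def x)
  \<comment> \<open>For \<open>i = j = k\<close> both corrections apply, but the weight of a loop vanishes.\<close>
  have flip: "weight G i j * (y $ i * y $ j) = weight G i j * (x $ i * x $ j)
      - 2 * (if i = k then x $ k * (weight G k j * x $ j) else 0)
      - 2 * (if j = k then x $ k * (weight G k i * x $ i) else 0)" for i j
    by (auto simp: y_def reflect_def weight_loop weight_sym[of i k])
  have "(\<Sum>i\<in>UNIV. \<Sum>j\<in>UNIV. weight G i j * (y $ i * y $ j))
      = (\<Sum>i\<in>UNIV. \<Sum>j\<in>UNIV. weight G i j * (x $ i * x $ j))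
        - 2 * (\<Sum>i\<in>UNIV. \<Sum>j\<in>UNIV. if i = k then x $ k * (weight G k j * x $ j) else 0)
        - 2 * (\<Sum>i\<in>UNIV. \<Sum>j\<in>UNIV. if j = k then x $ k * (weight G k i * x $ i) else 0)"
    unfolding flip by (simp only: sum_subtractf sum_distrib_left[symmetric])
  also have "(\<Sum>i\<in>UNIV. \<Sum>j\<in>UNIV. if i = k then x $ k * (weight G k j * x $ j) else 0) = R"
    by (subst sum.swap) (simp add: R_def sum_distrib_left)
  also have "(\<Sum>i\<in>UNIV. \<Sum>j\<in>UNIV. if j = k then x $ k * (weight G k i * x $ i) else 0) = R"
    by (simp add: R_def sum_distrib_left)
  finally have "2 * Iplus G y = 2 * Iplus G x - 4 * R / c"
    unfolding quad[OF y] quad[OF x] by (simp add: diff_divide_distrib)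
  thus ?thesis by (simp add: y_def R_def)
qed

text \<open>The corrections \<open>\<mp>q\<^sub>i\<close> in \<open>b\<^sub>i\<close> choose, for each edge with \<open>x\<^sub>i + x\<^sub>j = 0\<close>, the derivative of
  \<open>\<bar>x\<^sub>i + x\<^sub>j\<bar>\<close> opposite to the sign of \<open>x\<^sub>i\<close>. On two-valued vectors that is the sign of \<open>x\<^sub>j\<close>, as for the
  other edges. The resulting sum is the one by which a flip changes \<open>I\<^sup>+\<close>.\<close>

lemma bval_two_valued:
  assumes c: "0 < c" and x: "\<And>j. \<bar>x $ j\<bar> = c"
  shows "bval G x r a i = (\<Sum>j\<in>UNIV. weight G i j * x $ j) / c + r * a i"
proof -
  have inf: "infnorm x = c" using x by (rule infnorm_eq)
  have p: "pval G x i = (\<Sum>j\<in>UNIV. weight G i j * sign1 (x $ i + x $ j)) - qval G x i"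
    unfolding pval_def by (simp only: sum_neighbours)
  have q: "qval G x i = (\<Sum>j\<in>UNIV. weight G i j * (if x $ i + x $ j = 0 then 1 else 0))"
    unfolding qval_def NEN_def
    by (rule sum.mono_neutral_cong_left) (auto, metis weight_off_edge)
  have xi: "x $ i = c \<or> x $ i = - c" and xj: "x $ j = c \<or> x $ j = - c" for j
    using x[of i] x[of j] by linarith+
  \<comment> \<open>Used with \<open>t = -1\<close> where \<open>x\<^sub>i = c\<close> and with \<open>t = 1\<close> where \<open>x\<^sub>i = -c\<close>.\<close>
  have pq: "pval G x i + t * qval G x i
     = (\<Sum>j\<in>UNIV. weight G i j * (sign1 (x $ i + x $ j) + (t - 1) * (if x $ i + x $ j = 0 then 1 else 0)))"
    for t
    unfolding p by (simp only: distrib_left sum.distrib, simp only: q sum_distrib_left)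
      (simp add: algebra_simps sum.distrib[symmetric] sum_subtractf[symmetric] cong: if_cong)
  show ?thesis
  proof (cases "x $ i = c")
    case True
    have "bval G x r a i = pval G x i + (-1) * qval G x i + r * a i"
      by (simp add: bval_def Splus_def inf True)
    also have "pval G x i + (-1) * qval G x i = (\<Sum>j\<in>UNIV. weight G i j * (x $ j / c))"
    proof -
      have "sign1 (x $ i + x $ j) + ((-1) - 1) * (if x $ i + x $ j = 0 then 1 else 0) = x $ j / c" for j
        using xj[of j] True c by (elim disjE) (simp_all add: sign1_def)
      thus ?thesis unfolding pq by (simp only:)
    qed
    finally show ?thesis by (simp add: sum_divide_distrib)
  next
    case False
    hence xi': "x $ i = - c" using xi by simp
    have "bval G x r a i = pval G x i + 1 * qval G x i + r * a i"
      using c by (simp add: bval_def Splus_def Sminus_def inf xi')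
    also have "pval G x i + 1 * qval G x i = (\<Sum>j\<in>UNIV. weight G i j * (x $ j / c))"
    proof -
      have "sign1 (x $ i + x $ j) + (1 - 1) * (if x $ i + x $ j = 0 then 1 else 0) = x $ j / c" for j
        using xj[of j] xi' c by (elim disjE) (simp_all add: sign1_def)
      thus ?thesis unfolding pq by (simp only:)
    qed
    finally show ?thesis by (simp add: sum_divide_distrib)
  qed
qed

lemma deviation_reflect:
  "deviation G (reflect i x) t
    = deviation G x t + mass G i * (\<bar>x $ i + t\<bar> - \<bar>x $ i - t\<bar>)"
proof -
  have "deviation G (reflect i x) t = mass G i * \<bar>- x $ i - t\<bar>
      + (\<Sum>j\<in>UNIV - {i}. mass G j * \<bar>x $ j - t\<bar>)"
    unfolding deviation_def by (subst sum.remove[of _ i]) (auto simp: reflect_def)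
  moreover have "deviation G x t = mass G i * \<bar>x $ i - t\<bar>
      + (\<Sum>j\<in>UNIV - {i}. mass G j * \<bar>x $ j - t\<bar>)"
    unfolding deviation_def by (subst sum.remove[of _ i]) auto
  moreover have "\<bar>- x $ i - t\<bar> = \<bar>x $ i + t\<bar>" by linarith
  ultimately show ?thesis by (simp add: algebra_simps)
qed

lemma deviation_two_valued:
  assumes x: "\<And>j. \<bar>x $ j\<bar> = c" and t: "\<bar>t\<bar> = c"
  shows "deviation G x t = 2 * c * (\<Sum>j | x $ j = - t. mass G j)"
proof -
  have "deviation G x t = (\<Sum>j | x $ j = - t. mass G j * \<bar>x $ j - t\<bar>)"
    unfolding deviation_def
  proof (rule sum.mono_neutral_right)
    show "\<forall>j\<in>UNIV - {j. x $ j = - t}. mass G j * \<bar>x $ j - t\<bar> = 0"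
    proof
      fix j assume "j \<in> UNIV - {j. x $ j = - t}"
      thus "mass G j * \<bar>x $ j - t\<bar> = 0" using x[of j] t by auto
    qed
  qed auto
  also have "\<dots> = (\<Sum>j | x $ j = - t. 2 * c * mass G j)"
  proof (rule sum.cong)
    fix j assume "j \<in> {j. x $ j = - t}"
    hence "\<bar>x $ j - t\<bar> = 2 * c" using t by auto
    thus "mass G j * \<bar>x $ j - t\<bar> = 2 * c * mass G j" by simp
  qed simp
  finally show ?thesis by (simp add: sum_distrib_left)
qed

text \<open>The deviation is affine between the two values \<open>\<plusminus>c\<close> and strictly monotone outside of them.
  Hence a minimizer lies between them, and unless it is the endpoint \<open>t\<close>, the other endpoint is a
  minimizer as well.\<close>

lemma median_two_valued:
  assumes c: "0 < c" and x: "\<And>j. \<bar>x $ j\<bar> = c" and i: "x $ i = t"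
    and \<alpha>: "is_arg_min (deviation G x) (\<lambda>_. True) \<alpha>" and ne: "\<alpha> \<noteq> t"
  shows "\<bar>\<alpha>\<bar> \<le> c" and "deviation G x (- t) = deviation G x \<alpha>"
proof -
  have min: "deviation G x \<alpha> \<le> deviation G x y" for y
    using \<alpha> by (auto simp: is_arg_min_linorder)
  have tc: "t = c \<or> t = - c" using x[of i] i by linarith
  have xj: "x $ j = c \<or> x $ j = - c" for j using x[of j] by linarith
  show bd: "\<bar>\<alpha>\<bar> \<le> c"
  proof (rule ccontr)
    assume "\<not> \<bar>\<alpha>\<bar> \<le> c"
    \<comment> \<open>The endpoint of \<open>[-c, c]\<close> nearest to \<open>\<alpha>\<close> is closer to both values than \<open>\<alpha>\<close>.\<close>
    define y where "y = sgn \<alpha> * c"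
    have "deviation G x y < deviation G x \<alpha>"
      unfolding deviation_def
    proof (rule sum_strict_mono)
      fix j
      have "\<bar>x $ j - y\<bar> < \<bar>x $ j - \<alpha>\<bar>"
        using xj[of j] \<open>\<not> \<bar>\<alpha>\<bar> \<le> c\<close> c by (auto simp: y_def sgn_if abs_if split: if_splits)
      thus "mass G j * \<bar>x $ j - y\<bar> < mass G j * \<bar>x $ j - \<alpha>\<bar>"
        by (simp add: mass_pos)
    qed auto
    thus False using min[of y] by simp
  qed
  \<comment> \<open>Here \<open>\<alpha>\<close> is the convex combination of \<open>-c\<close> and \<open>c\<close> with weights \<open>(c - \<alpha>) / (2 c)\<close> and
    \<open>(c + \<alpha>) / (2 c)\<close>.\<close>
  have convex: "2 * c * \<bar>x $ j - \<alpha>\<bar> = (c - \<alpha>) * \<bar>x $ j - (- c)\<bar> + (c + \<alpha>) * \<bar>x $ j - c\<bar>" for j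
  proof -
    have "\<bar>c - \<alpha>\<bar> = c - \<alpha>" "\<bar>- c - \<alpha>\<bar> = c + \<alpha>" "\<bar>c - (- c)\<bar> = 2 * c" "\<bar>- c - c\<bar> = 2 * c"
      using bd c by linarith+
    thus ?thesis using xj[of j] by (elim disjE) (simp_all del: minus_diff_eq diff_minus_eq_add)
  qed
  have "2 * c * (mass G j * \<bar>x $ j - \<alpha>\<bar>)
      = (c - \<alpha>) * (mass G j * \<bar>x $ j - (- c)\<bar>) + (c + \<alpha>) * (mass G j * \<bar>x $ j - c\<bar>)" for j
  proof -
    have scale: "k * (m * A) = p * (m * B) + q * (m * C)" if "k * A = p * B + q * C"
      for k m p q A B C :: real
    proof -
      have "k * (m * A) = m * (p * B + q * C)" by (simp flip: that)
      thus ?thesis by (simp add: distrib_left mult.left_commute)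
    qed
    show ?thesis by (rule scale) (rule convex)
  qed
  hence lin: "2 * c * deviation G x \<alpha> = (c - \<alpha>) * deviation G x (- c) + (c + \<alpha>) * deviation G x c"
    unfolding deviation_def sum_distrib_left by (simp only: sum.distrib)
  define d where "d y = deviation G x y - deviation G x \<alpha>" for y
  have d: "0 \<le> d y" for y using min[of y] by (simp add: d_def)
  have lin': "(c - \<alpha>) * d (- c) + (c + \<alpha>) * d c = 0"
    using lin by (simp add: d_def algebra_simps)
  have nn: "0 \<le> (c - \<alpha>) * d (- c)" "0 \<le> (c + \<alpha>) * d c"
    using bd d by (auto intro!: mult_nonneg_nonneg)
  have "(c - \<alpha>) * d (- c) = 0" "(c + \<alpha>) * d c = 0"
    using lin' nn by linarith+
  hence "d (- t) = 0"
    using tc ne by auto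
  thus "deviation G x (- t) = deviation G x \<alpha>" by (simp add: d_def)
qed

text \<open>The minimum for the flipped vector is bounded by its deviations from the two values \<open>x\<^sub>i\<close> and
  \<open>-x\<^sub>i\<close>, and these differ from the deviations of \<open>x\<close> by \<open>\<plusminus>2 c \<mu>\<^sub>i\<close>. If \<open>\<alpha> \<noteq> x\<^sub>i\<close>, then
  \<open>\<bar>a\<^sub>i\<bar> = \<mu>\<^sub>i\<close> and the value \<open>-x\<^sub>i\<close> alone gives the bound. If \<open>\<alpha> = x\<^sub>i\<close>, the smaller one of the two
  bounds is what the minimum or maximum in \<open>a\<^sub>i\<^sup>R\<close> or \<open>a\<^sub>i\<^sup>L\<close> expresses. In that case, that the flipped
  vector is nonconstant provides a second vertex with value \<open>\<alpha>\<close>, so that \<open>a\<^sub>i\<close> is indeed defined by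
  these formulas.\<close>

lemma Nfun_reflect_le:
  assumes c: "0 < c" and x: "\<And>j. \<bar>x $ j\<bar> = c"
    and \<alpha>: "is_arg_min (deviation G x) (\<lambda>_. True) \<alpha>"
    and a: "a_choice G x r \<alpha> a"
    and nc: "nonconstant (reflect i x)"
  shows "Nfun G (reflect i x) \<le> Nfun G x - 2 * (x $ i * a i)"
proof -
  define m where "m = mass G i"
  have inf: "infnorm x = c" using x by (rule infnorm_eq)
  have xj: "x $ j = c \<or> x $ j = - c" for j using x[of j] by linarith
  have N: "Nfun G x = deviation G x \<alpha>" using \<alpha> by (rule Nfun_attained)
  have xi: "\<bar>x $ i + x $ i\<bar> = 2 * c" using x[of i] by linarith
  have minus: "Nfun G (reflect i x) \<le> deviation G x (- x $ i) - 2 * c * m"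
    using Nfun_le[of "reflect i x" "- x $ i"] xi by (simp add: deviation_reflect m_def mult_ac)
  have plus: "Nfun G (reflect i x) \<le> deviation G x (x $ i) + 2 * c * m"
    using Nfun_le[of "reflect i x" "x $ i"] xi by (simp add: deviation_reflect m_def mult_ac)
  show ?thesis
  proof (cases "\<alpha> = x $ i")
    case False
    note med = median_two_valued[OF c x refl \<alpha> False]
    have ai: "a i = m * sign1 (x $ i - \<alpha>)"
      using a False by (auto simp: a_choice_def Salpha_def m_def)
    have "x $ i * sign1 (x $ i - \<alpha>) = c"
      using xj[of i] med(1) False c by (auto simp: sign1_def abs_if split: if_splits)
    hence "x $ i * a i = c * m" by (simp add: ai mult.left_commute)
    thus ?thesis using minus med(2) N by simp
  next
    case True
    have "\<exists>j. j \<noteq> i \<and> x $ j = x $ i"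
    proof (rule ccontr)
      assume alone: "\<not> ?thesis"
      have "reflect i x $ j = - x $ i" for j
        using alone xj[of i] xj[of j] by (auto simp: reflect_def)
      thus False using nc by (simp add: nonconstant_def)
    qed
    then obtain j where j: "j \<noteq> i" "x $ j = x $ i" by blast
    have mem: "{i, j} \<subseteq> Salpha x \<alpha>" using j True by (auto simp: Salpha_def)
    have "card {i, j} \<le> card (Salpha x \<alpha>)" by (rule card_mono[OF _ mem]) simp
    hence card: "2 \<le> card (Salpha x \<alpha>)" using j by simp
    define M where "M = Mval G x \<alpha>"
    define Q where "Q = (\<Sum>j | x $ j = - \<alpha>. mass G j)"
    have dplus: "deviation G x (x $ i) = 2 * c * Q"
      using deviation_two_valued[OF x x[of i]] by (simp add: Q_def True)
    have dminus: "deviation G x (- x $ i) = 2 * c * M"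
      using deviation_two_valued[OF x, of "- x $ i"] x[of i] by (simp add: M_def Mval_def True)
    have "x $ i * a i = - (c * min (M - Q - m) m)"
    proof (cases "x $ i = c")
      case xc: True
      have "{j. x $ j < \<alpha>} = {j. x $ j = - \<alpha>}" "{j. x $ j > \<alpha>} = {}"
      proof -
        have "(x $ j < \<alpha>) = (x $ j = - \<alpha>)" "\<not> x $ j > \<alpha>" for j
          using xj[of j] c True xc by auto
        thus "{j. x $ j < \<alpha>} = {j. x $ j = - \<alpha>}" "{j. x $ j > \<alpha>} = {}" by auto
      qed
      hence "Aval G x \<alpha> = Q" by (simp add: Aval_def Q_def)
      moreover have "a i = aL G x \<alpha> i"
        using a mem card xc by (auto simp: a_choice_def Splus_def inf)
      ultimately have "a i = max (Q - M + m) (- m)"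
        using mem card by (simp add: aL_def M_def m_def)
      thus ?thesis by (simp add: xc max_def min_def algebra_simps)
    next
      case False
      hence xc: "x $ i = - c" using xj[of i] by simp
      have "{j. x $ j > \<alpha>} = {j. x $ j = - \<alpha>}" "{j. x $ j < \<alpha>} = {}"
      proof -
        have "(x $ j > \<alpha>) = (x $ j = - \<alpha>)" "\<not> x $ j < \<alpha>" for j
          using xj[of j] c True xc by auto
        thus "{j. x $ j > \<alpha>} = {j. x $ j = - \<alpha>}" "{j. x $ j < \<alpha>} = {}" by auto
      qed
      hence "Aval G x \<alpha> = - Q" by (simp add: Aval_def Q_def)
      moreover have "a i = aR G x \<alpha> i"
        using a mem card xc by (auto simp: a_choice_def Sminus_def inf)
      ultimately have "a i = min (M - Q - m) m"
        using mem card by (simp add: aR_def M_def m_def)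
      thus ?thesis by (simp add: xc)
    qed
    thus ?thesis
      using plus minus N unfolding dplus dminus True
      by (auto simp: min_def algebra_simps)
  qed
qed

text \<open>With \<open>r = B(x) \<ge> 0\<close>, the changes of \<open>I\<^sup>+\<close> and of \<open>r N\<close> add up to at most \<open>-2 x\<^sub>i b\<^sub>i\<close>, so the flip
  does not raise \<open>H\<^sub>r\<close> above the common maximum norm.\<close>

lemma Bfun_reflect_ge:
  assumes c: "0 < c" and x: "\<And>j. \<bar>x $ j\<bar> = c" and ncx: "nonconstant x"
    and \<alpha>: "is_arg_min (deviation G x) (\<lambda>_. True) \<alpha>"
    and a: "a_choice G x (Bfun G x) \<alpha> a"
    and nc: "nonconstant (reflect i x)"
    and b: "0 \<le> x $ i * bval G x (Bfun G x) a i"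
  shows "Bfun G x \<le> Bfun G (reflect i x)"
proof -
  define r where "r = Bfun G x"
  define y where "y = reflect i x"
  have "r * Nfun G y \<le> r * (Nfun G x - 2 * (x $ i * a i))"
    using Nfun_reflect_le[OF c x \<alpha> a nc] Bfun_nonneg[of x]
    by (auto intro: mult_left_mono simp: r_def y_def)
  hence "Iplus G y + r * Nfun G y \<le> Iplus G x + r * Nfun G x - 2 * (x $ i * bval G x r a i)"
    unfolding y_def Iplus_reflect[OF c x] bval_two_valued[OF c x]
    by (simp add: algebra_simps)
  also have "\<dots> \<le> Iplus G x + r * Nfun G x"
    using b by (simp add: r_def)
  finally have "Hfun G r y \<le> Hfun G r x"
    unfolding Hfun_def using vol_pos by (simp add: divide_right_mono)
  also have "\<dots> = infnorm y"
    using Hfun_Bfun[OF ncx] by (simp add: r_def y_def infnorm_reflect)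
  finally show ?thesis
    using Hfun_le_iff_le_Bfun[OF nc] by (simp add: r_def y_def)
qed


section \<open>What the selected subgradient detects\<close>

text \<open>A vertex can be picked exactly when some \<open>b\<^sub>i\<close> has the sign opposite to \<open>x\<^sub>i\<close>, because all
  vertices of a two-valued vector belong to \<open>S\<^sup>+\<close> or \<open>S\<^sup>-\<close> and an argmax over a nonempty finite set
  exists.\<close>

lemma Vb_two_valued:
  assumes c: "0 < c" and x: "\<And>j. \<bar>x $ j\<bar> = c"
  shows Vb_wrong_sign: "k \<in> Vb x b \<Longrightarrow> x $ k * b k < 0"
    and Vb_empty: "Vb x b = {} \<Longrightarrow> 0 \<le> x $ k * b k"
proof -
  have inf: "infnorm x = c" using x by (rule infnorm_eq)
  show "x $ k * b k < 0" if "k \<in> Vb x b"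
    using that c x[of k]
    by (auto simp: Vb_def is_arg_max_def Splus_def Sminus_def Sless_def inf mult_less_0_iff)
  have ex: "\<exists>i. is_arg_max (\<lambda>i. \<bar>b i\<bar>) P i" if "P k" for P
    using ex_is_arg_min_if_finite[of "{i. P i}" "\<lambda>i. - \<bar>b i\<bar>"] that
    by (auto simp: is_arg_min_def is_arg_max_def)
  show "0 \<le> x $ k * b k" if "Vb x b = {}"
  proof (rule ccontr)
    assume "\<not> ?thesis"
    hence neg: "x $ k * b k < 0" by simp
    consider "x $ k = c" | "x $ k = - c" using x[of k] by linarith
    thus False
    proof cases
      case 1
      hence "k \<in> Splus x \<and> b k < 0"
        using neg c by (simp add: Splus_def inf mult_less_0_iff)
      from ex[of "\<lambda>i. i \<in> Splus x \<and> b i < 0", OF this] show False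
        using that by (auto simp: Vb_def)
    next
      case 2
      hence "k \<in> Sminus x \<and> 0 < b k"
        using neg c by (simp add: Sminus_def inf zero_less_mult_iff mult_less_0_iff)
      from ex[of "\<lambda>i. i \<in> Sminus x \<and> 0 < b i", OF this] show False
        using that by (auto simp: Vb_def)
    qed
  qed
qed

text \<open>The picked vertex decides all ties at its own edges and is its own \<open>j\<^sup>*\<close> if it lies in
  \<open>S\<^sup>\<alpha>\<close>. Therefore the selected subgradient attains the extreme value \<open>b\<^sub>k\<close> there.\<close>

lemma picked_component:
  assumes c: "0 < c" and x: "\<And>j. \<bar>x $ j\<bar> = c"
  shows "uval G x (chi G x \<alpha> a) \<sigma> (Some k) k + r * vval G x \<alpha> a \<sigma> (Some k) k = bval G x r a k"
proof -
  have inf: "infnorm x = c" using x by (rule infnorm_eq)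
  have v: "vval G x \<alpha> a \<sigma> (Some k) k = a k"
    by (simp add: vval_def jstar_def)
  have u: "uval G x (chi G x \<alpha> a) \<sigma> (Some k) k = pval G x k + qval G x k * chi G x \<alpha> a k"
    by (simp add: uval_def qval_def sum_distrib_right)
  consider "x $ k = c" | "x $ k = - c" using x[of k] by linarith
  thus ?thesis
    by cases (use c in \<open>auto simp: u v bval_def chi_def Splus_def Sminus_def inf\<close>)
qed

lemma CB_if_selected_subgradient_has_right_signs:
  assumes c: "0 < c" and x: "\<And>j. \<bar>x $ j\<bar> = c" and nc: "nonconstant x"
    and sel: "subgradient_selection G x (Bfun G x) s"
    and sgn: "\<And>i. 0 \<le> x $ i * s $ i"
  shows "x \<in> CB G"
proof -
  define r where "r = Bfun G x"
  obtain \<alpha> a \<sigma> picked where \<alpha>: "is_arg_min (deviation G x) (\<lambda>_. True) \<alpha>"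
    and a: "a_choice G x r \<alpha> a"
    and pick: "case picked of None \<Rightarrow> Vb x (bval G x r a) = {} | Some k \<Rightarrow> k \<in> Vb x (bval G x r a)"
    and s: "s = (\<chi> i. (uval G x (chi G x \<alpha> a) \<sigma> picked i + r * vval G x \<alpha> a \<sigma> picked i) / vol G)"
    using sel unfolding subgradient_selection_def r_def by blast
  have "picked = None"
  proof (cases picked)
    case (Some k)
    have "s $ k = bval G x r a k / vol G"
      by (simp add: s Some picked_component[OF c x])
    moreover have "x $ k * bval G x r a k < 0"
      using pick Vb_wrong_sign[OF c x] by (simp add: Some)
    ultimately have "x $ k * s $ k < 0"
      using vol_pos by (simp add: divide_neg_pos)
    thus ?thesis using sgn[of k] by simp
  qed
  hence "0 \<le> x $ i * bval G x r a i" for i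
    using pick Vb_empty[OF c x] by simp
  thus ?thesis
    using Bfun_reflect_ge[OF c x nc \<alpha>] a nc by (simp add: CB_def r_def)
qed

end


section \<open>The inner problem\<close>

text \<open>The equality case of Hoelder's inequality: the sum over \<open>i\<close> of the nonnegative numbers
  \<open>\<bar>s\<^sub>i\<bar> \<parallel>x\<parallel>\<^sub>\<infinity> - s\<^sub>i x\<^sub>i\<close> is at most 0, so each of them vanishes.\<close>

lemma inner_eq_infnorm_signs:
  fixes s x :: "real ^ 'n::finite"
  assumes "l1norm s \<le> 1" and "s \<bullet> x = infnorm x"
  shows "s $ i * x $ i = \<bar>s $ i\<bar> * infnorm x"
proof -
  have nn: "0 \<le> \<bar>s $ i\<bar> * infnorm x - s $ i * x $ i" for i
  proof -
    have "s $ i * x $ i \<le> \<bar>s $ i\<bar> * \<bar>x $ i\<bar>"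
      by (simp flip: abs_mult)
    also have "\<dots> \<le> \<bar>s $ i\<bar> * infnorm x"
      by (simp add: mult_left_mono component_le_infnorm_cart)
    finally show ?thesis by simp
  qed
  have "(\<Sum>i\<in>UNIV. \<bar>s $ i\<bar> * infnorm x - s $ i * x $ i) = l1norm s * infnorm x - infnorm x"
    using assms(2) by (simp add: sum_subtractf l1norm_def sum_distrib_right inner_vec_def)
  also have "\<dots> \<le> 0"
    using assms(1) mult_right_mono[OF assms(1) infnorm_pos_le[of x]] by simp
  finally have "(\<Sum>i\<in>UNIV. \<bar>s $ i\<bar> * infnorm x - s $ i * x $ i) = 0"
    using nn by (simp add: order_antisym sum_nonneg)
  hence "\<bar>s $ i\<bar> * infnorm x - s $ i * x $ i = 0"
    using nn by (simp add: sum_nonneg_eq_0_iff)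
  thus ?thesis by simp
qed

text \<open>The competitor with entries \<open>\<plusminus>1/n\<close> and the signs of \<open>s\<close>. Its value is negative as soon as
  \<open>\<parallel>s\<parallel>\<^sub>1 > 1\<close>.\<close>

lemma sign_vector_value:
  fixes s :: "real ^ 'n::finite"
  obtains y where "l1norm y \<le> 1" and "infnorm y - y \<bullet> s = (1 - l1norm s) / CARD('n)"
proof -
  define y :: "real ^ 'n" where "y = (\<chi> i. sign1 (s $ i) / CARD('n))"
  have abs: "\<bar>y $ i\<bar> = 1 / CARD('n)" for i
    by (simp add: y_def sign1_def)
  have "y \<bullet> s = l1norm s / CARD('n)"
    unfolding inner_vec_def l1norm_def sum_divide_distrib
    by (rule sum.cong) (auto simp: y_def sign1_def)
  hence "infnorm y - y \<bullet> s = (1 - l1norm s) / CARD('n)"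
    using infnorm_eq[of y, OF abs] by (simp add: diff_divide_distrib)
  moreover have "l1norm y \<le> 1"
    by (simp add: l1norm_def abs)
  ultimately show ?thesis by (rule that[rotated])
qed

lemma solution_case_ii_two_valued:
  fixes s x :: "real ^ 'n::finite"
  assumes "solution_case_ii s x"
  obtains c where "0 < c" and "\<And>i. \<bar>x $ i\<bar> = c"
    and "\<And>i. s $ i \<noteq> 0 \<Longrightarrow> x $ i = c * sign1 (s $ i)"
    and "(\<exists>i. s $ i = 0) \<Longrightarrow> nonconstant x"
proof -
  obtain y where y1: "\<And>i. s $ i \<noteq> 0 \<Longrightarrow> y $ i = sign1 (s $ i)"
    and y0: "{i. s $ i = 0} \<noteq> {} \<Longrightarrow> \<exists>j. s $ j \<noteq> 0 \<and> (\<exists>i. s $ i = 0 \<and> y $ i = - y $ j \<and>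
        (\<forall>t\<in>{i. s $ i = 0} - {i}. y $ t \<in> {-1, 1}))"
    and x: "x = (1 / l1norm y) *\<^sub>R y"
    using assms unfolding solution_case_ii_def Let_def by auto
  have abs: "\<bar>y $ i\<bar> = 1" for i
  proof (cases "s $ i = 0")
    case False thus ?thesis by (simp add: y1 sign1_def)
  next
    case True
    then obtain j k where jk: "s $ j \<noteq> 0" "s $ k = 0" "y $ k = - y $ j"
        "\<forall>t\<in>{i. s $ i = 0} - {k}. y $ t \<in> {-1, 1}"
      using y0 by blast
    hence "i \<noteq> k \<Longrightarrow> y $ i \<in> {-1, 1}" using True by blast
    thus ?thesis
      using jk(1,3) y1[of j] by (cases "i = k") (auto simp: sign1_def)
  qed
  have l: "l1norm y = CARD('n)" by (simp add: l1norm_def abs)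
  show ?thesis
  proof
    show "0 < 1 / real CARD('n)" by simp
    show "\<bar>x $ i\<bar> = 1 / real CARD('n)" for i
      using abs[of i] by (simp add: x l abs_mult)
    show "x $ i = 1 / real CARD('n) * sign1 (s $ i)" if "s $ i \<noteq> 0" for i
      by (simp add: x l y1 that)
    show "nonconstant x" if "\<exists>i. s $ i = 0"
    proof -
      from y0 that obtain j i where "y $ i = - y $ j" by blast
      hence "y $ i \<noteq> y $ j" using abs[of j] by auto
      hence "x $ i \<noteq> x $ j" by (simp add: x l)
      thus ?thesis by (auto simp: nonconstant_def)
    qed
  qed
qed


section \<open>The iteration\<close>

context
  fixes G :: "'n::finite wgraph" and x s :: "nat \<Rightarrow> real ^ 'n" and r :: "nat \<Rightarrow> real"
  assumes graph: "weighted_graph G" and sip: "SIP G x r s"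
begin

lemma SIP_r: "r k = Bfun G (x k)"
  using sip unfolding SIP_def by blast

lemma SIP_subgradient: "s k \<bullet> x k = Hfun G (r k) (x k)" "s k \<bullet> y \<le> Hfun G (r k) y"
proof -
  have "0 \<le> r k" "s k \<in> subdifferential (Hfun G (r k)) (x k)"
    using sip Bfun_nonneg[OF graph] SIP_r unfolding SIP_def by auto
  thus "s k \<bullet> x k = Hfun G (r k) (x k)" "s k \<bullet> y \<le> Hfun G (r k) y"
    using subgradient_Hfun[OF graph] by blast+
qed

lemma SIP_minimal: "l1norm y \<le> 1 \<Longrightarrow> infnorm (x (Suc k)) - x (Suc k) \<bullet> s k \<le> infnorm y - y \<bullet> s k"
  using sip unfolding SIP_def by (auto simp: is_arg_min_linorder)

lemma SIP_next_value:
  "infnorm (x (Suc k)) - x (Suc k) \<bullet> s k \<le> (1 - l1norm (s k)) / CARD('n)"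
proof -
  obtain y where "l1norm y \<le> 1" "infnorm y - y \<bullet> s k = (1 - l1norm (s k)) / CARD('n)"
    by (rule sign_vector_value)
  thus ?thesis using SIP_minimal[of y k] by simp
qed

text \<open>A constant next iterate would make the minimum of the inner problem nonnegative, which
  leaves only the rule for \<open>\<parallel>s\<parallel>\<^sub>1 = 1\<close>. That rule makes \<open>x'\<close> nonconstant on purpose if \<open>s\<close> has a
  zero component. If \<open>s\<close> has none, then \<open>\<langle>x, s\<rangle> = \<parallel>x\<parallel>\<^sub>\<infinity>\<close> forces the old iterate \<open>x\<close> to be a multiple of the
  sign vector of \<open>s\<close>, as is \<open>x'\<close>, and \<open>x\<close> is nonconstant by induction.\<close>

lemma SIP_nonconstant: "nonconstant (x k)"
proof (induction k)
  case 0
  show ?case using sip unfolding SIP_def by blast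
next
  case (Suc k)
  have sel: "1 < l1norm (s k) \<or> l1norm (s k) = 1 \<and> solution_case_ii (s k) (x (Suc k))"
    using sip unfolding SIP_def solution_selection_def by blast
  show ?case
  proof (rule ccontr)
    assume const: "\<not> nonconstant (x (Suc k))"
    have "0 \<le> infnorm (x (Suc k)) - x (Suc k) \<bullet> s k"
      using SIP_subgradient(2)[of k "x (Suc k)"] Hfun_constant_le[OF graph const]
      by (metis diff_ge_0_iff_ge inner_commute order_trans)
    hence "0 \<le> (1 - l1norm (s k)) / CARD('n)"
      using SIP_next_value order_trans by blast
    hence "\<not> 1 < l1norm (s k)"
      by (simp add: zero_le_divide_iff)
    hence l1: "l1norm (s k) = 1" and case_ii: "solution_case_ii (s k) (x (Suc k))"
      using sel by auto
    obtain c where c: "0 < c" "\<And>i. s k $ i \<noteq> 0 \<Longrightarrow> x (Suc k) $ i = c * sign1 (s k $ i)"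
        "(\<exists>i. s k $ i = 0) \<Longrightarrow> nonconstant (x (Suc k))"
      using solution_case_ii_two_valued[OF case_ii] by metis
    have nz: "s k $ i \<noteq> 0" for i using c(3) const by blast
    have "s k \<bullet> x k = infnorm (x k)"
      using SIP_subgradient(1) SIP_r Hfun_Bfun[OF graph Suc.IH] by simp
    from inner_eq_infnorm_signs[OF _ this] l1
    have "s k $ i * x k $ i = \<bar>s k $ i\<bar> * infnorm (x k)" for i by simp
    hence "s k $ i * x k $ i = s k $ i * (sign1 (s k $ i) * infnorm (x k))" for i
      by (simp add: sign1_def abs_if)
    hence "x k $ i = sign1 (s k $ i) * infnorm (x k)" for i
      using nz[of i] mult_left_cancel by blast
    moreover have "sign1 (s k $ i) = sign1 (s k $ j)" for i j
      using const c(1,2) nz by (metis nonconstant_def mult_cancel_left less_irrefl)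
    ultimately have "x k $ i = x k $ j" for i j by metis
    thus False using Suc.IH by (auto simp: nonconstant_def)
  qed
qed

lemma SIP_inner: "s k \<bullet> x k = infnorm (x k)"
  using SIP_subgradient(1) SIP_r Hfun_Bfun[OF graph SIP_nonconstant] by simp

lemma SIP_stationary: "l1norm (s k) \<le> 1" if "r (Suc k) = r k"
proof -
  have "Hfun G (r k) (x (Suc k)) = infnorm (x (Suc k))"
    using Hfun_Bfun[OF graph SIP_nonconstant[of "Suc k"]] SIP_r[of "Suc k"] that by simp
  hence "0 \<le> infnorm (x (Suc k)) - x (Suc k) \<bullet> s k"
    using SIP_subgradient(2)[of k "x (Suc k)"] by (simp add: inner_commute)
  hence "0 \<le> (1 - l1norm (s k)) / CARD('n)"
    using SIP_next_value order_trans by blast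
  thus ?thesis by (simp add: zero_le_divide_iff)
qed

text \<open>Two consecutive steps without progress are used: the first one makes the iterate two-valued,
  the second one bounds the 1-norm of the subgradient selected there.\<close>

lemma SIP_stationary_CB:
  assumes "r (Suc k) = r k" and "r (Suc (Suc k)) = r (Suc k)"
  shows "x (Suc k) \<in> CB G"
proof -
  have "solution_case_ii (s k) (x (Suc k))"
    using sip SIP_stationary[OF assms(1)] unfolding SIP_def solution_selection_def
    by (metis not_le)
  then obtain c where c: "0 < c" and abs: "\<And>i. \<bar>x (Suc k) $ i\<bar> = c"
    using solution_case_ii_two_valued by metis
  have sel: "subgradient_selection G (x (Suc k)) (Bfun G (x (Suc k))) (s (Suc k))"
    using sip SIP_r unfolding SIP_def by metis
  have "0 \<le> x (Suc k) $ i * s (Suc k) $ i" for i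
    using inner_eq_infnorm_signs[OF SIP_stationary[OF assms(2)] SIP_inner, of i]
      infnorm_pos_le[of "x (Suc k)"] by (simp add: mult.commute)
  thus ?thesis
    by (rule CB_if_selected_subgradient_has_right_signs[OF graph c abs SIP_nonconstant sel])
qed

end

theorem theorem3p6:
  fixes G :: "'n::finite wgraph"
    and x s :: "nat \<Rightarrow> real ^ 'n"
    and r :: "nat \<Rightarrow> real"
    and xstar :: "real ^ 'n"
  assumes "CARD('n) \<ge> 2"
    and "weighted_graph G"
    and "SIP G x r s"
    and "SIP_converges_to x r xstar"
  shows "xstar \<in> CB G"
proof -
  obtain N rstar k where "\<forall>k>N. r k = rstar" "k > N" "xstar = x (Suc k)"
    using assms(4) unfolding SIP_converges_to_def by blast
  thus ?thesis
    using SIP_stationary_CB[OF assms(2,3), of k] by simp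
qed

end
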